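(* Let $p,q,r\in\mathbf{Q}_{>0}$ be such that at least two among $p,q,r$ are integers. Then $$\mathsf{F}(p+q)\,\mathsf{F}(p+r)-\mathsf{F}(p)\,\mathsf{F}(p+q+r)=\mathrm{cds}(p)\,\mathsf{F}(q)\,\mathsf{F}(r).$$
   Context: The codenominator $\mathsf{F}:\mathbf{Q}_{>0}\to\mathbf{Z}_{>0}$ is the unique function with $\mathsf{F}(1)=1$ satisfying, for all $x\in\mathbf{Q}_{>0}$, $\mathsf{F}(1+1/x)=\mathsf{F}(x)$ and $\mathsf{F}\left(\frac{1}{1+x}\right)=\mathsf{F}(x)+\mathsf{F}(1/x)$. The codiscriminant $\mathrm{cds}:\mathbf{Q}_{>0}\to\mathbf{Z}$ is defined by $\mathrm{cds}(x):=\mathsf{F}(1/x)^2-\mathsf{F}(x)\mathsf{F}(1/x)-\mathsf{F}(x)^2$. *)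

theory Defs
  imports Complex_Main
begin

text \<open>
  A function on the positive rationals is encoded as a function on \<^typ>\<open>rat\<close> that is
  set to \<open>0\<close> outside its domain; without that convention the conditions below would not determine it.
\<close>

definition is_codenominator :: "(rat \<Rightarrow> int) \<Rightarrow> bool" where
  "is_codenominator f \<longleftrightarrow>
     (\<forall>x\<le>0. f x = 0) \<and>
     (\<forall>x>0. f x > 0) \<and>
     f 1 = 1 \<and>
     (\<forall>x>0. f (1 + 1 / x) = f x) \<and>
     (\<forall>x>0. f (1 / (1 + x)) = f x + f (1 / x))"

definition codenominator :: "rat \<Rightarrow> int" where
  "codenominator = (THE f. is_codenominator f)"

definition codiscriminant :: "rat \<Rightarrow> int" where
  "codiscriminant x =
     codenominator (1 / x) ^ 2 - codenominator x * codenominator (1 / x) - codenominator x ^ 2"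

text \<open>
  Existence and uniqueness, so that the definite description above is well defined.
  Existence uses subtractive Euclid on a pair of numerator and denominator.
\<close>

function codenom_pair :: "nat \<Rightarrow> nat \<Rightarrow> nat" where
  "codenom_pair a b =
     (if a = 0 \<or> b = 0 then 0
      else if a = b then 1
      else if b < a then codenom_pair b (a - b)
      else codenom_pair (b - a) a + codenom_pair a (b - a))"
  by auto
termination by (relation "Wellfounded.measure (\<lambda>(a, b). a + b)") auto

declare codenom_pair.simps [simp del]

lemma codenom_pair_pos: "a > 0 \<Longrightarrow> b > 0 \<Longrightarrow> codenom_pair a b > 0"
proof (induction a b rule: codenom_pair.induct)
  case (1 a b)
  then show ?case by (subst codenom_pair.simps) auto
qed

lemma codenom_pair_scale: "k > 0 \<Longrightarrow> codenom_pair (k * a) (k * b) = codenom_pair a b"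
proof (induction a b rule: codenom_pair.induct)
  case (1 a b)
  show ?case
    using 1
    by (subst (1 2) codenom_pair.simps) (auto simp flip: diff_mult_distrib2)
qed

definition codenom_witness :: "rat \<Rightarrow> int" where
  "codenom_witness x =
     (if x \<le> 0 then 0
      else int (codenom_pair (nat (fst (quotient_of x))) (nat (snd (quotient_of x)))))"

lemma pos_rat_cases:
  fixes x :: rat
  assumes "x > 0"
  obtains a b :: nat where "a > 0" "b > 0" "x = of_nat a / of_nat b"
    "a = nat (fst (quotient_of x))" "b = nat (snd (quotient_of x))"
proof -
  obtain m n where q: "quotient_of x = (m, n)" by fastforce
  then have n: "n > 0" by (rule quotient_of_denom_pos)
  have x: "x = of_int m / of_int n" using q by (rule quotient_of_div)
  have m: "m > 0" using assms n x by (simp add: zero_less_divide_iff)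
  show thesis
    by (rule that[of "nat m" "nat n"]) (use m n x q in auto)
qed

lemma codenom_witness_eq:
  assumes "a > 0" "b > 0"
  shows "codenom_witness (of_nat a / of_nat b) = int (codenom_pair a b)"
proof -
  let ?x = "of_nat a / of_nat b :: rat"
  have pos: "?x > 0" using assms by simp
  then obtain c d where cd: "c > 0" "d > 0" "?x = of_nat c / of_nat d"
    "c = nat (fst (quotient_of ?x))" "d = nat (snd (quotient_of ?x))"
    by (rule pos_rat_cases)
  have "(of_nat (a * d) :: rat) = of_nat (c * b)"
    using cd(3) assms cd(1,2) by (simp add: field_simps)
  then have e: "a * d = c * b" by (simp only: of_nat_eq_iff)
  have "codenom_pair a b = codenom_pair (d * a) (d * b)"
    using cd(2) by (simp add: codenom_pair_scale)
  also have "\<dots> = codenom_pair (b * c) (b * d)" using e by (simp add: mult.commute)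
  also have "\<dots> = codenom_pair c d" using assms by (simp add: codenom_pair_scale)
  finally show ?thesis using pos unfolding codenom_witness_def cd(4,5)[symmetric] by simp
qed

lemma is_codenominator_witness: "is_codenominator codenom_witness"
  unfolding is_codenominator_def
proof (intro conjI allI impI)
  fix x :: rat
  show "codenom_witness x = 0" if "x \<le> 0" using that by (simp add: codenom_witness_def)
next
  have "codenom_witness (of_nat 1 / of_nat 1) = int (codenom_pair 1 1)"
    by (rule codenom_witness_eq) auto
  then show "codenom_witness 1 = 1" by (simp add: codenom_pair.simps)
next
  fix x :: rat assume "x > 0"
  then obtain a b where ab: "a > 0" "b > 0" and x: "x = of_nat a / of_nat b"
    by (rule pos_rat_cases)
  show "codenom_witness x > 0"
    using ab by (simp add: x codenom_witness_eq codenom_pair_pos)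
  have i: "1 / x = of_nat b / of_nat a" by (simp add: x)
  have "1 + 1 / x = of_nat (a + b) / of_nat a" using ab by (simp add: x field_simps)
  moreover have "codenom_pair (a + b) a = codenom_pair a b"
    using ab by (subst codenom_pair.simps) simp
  ultimately show "codenom_witness (1 + 1 / x) = codenom_witness x"
    using ab codenom_witness_eq[of "a + b" a] by (simp add: x codenom_witness_eq)
  have "1 / (1 + x) = of_nat b / of_nat (a + b)" using ab by (simp add: x field_simps)
  moreover have "codenom_pair b (a + b) = codenom_pair a b + codenom_pair b a"
    using ab by (subst codenom_pair.simps) simp
  ultimately show "codenom_witness (1 / (1 + x)) = codenom_witness x + codenom_witness (1 / x)"
    unfolding i using ab codenom_witness_eq[of b "a + b"]
    by (simp add: x codenom_witness_eq)
qed

lemma is_codenominator_unique: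
  assumes f: "is_codenominator f" and g: "is_codenominator g"
  shows "f = g"
proof
  fix x
  have *: "f (of_nat a / of_nat b) = g (of_nat a / of_nat b)" if "a > 0" "b > 0" for a b
    using that
  proof (induction a b rule: codenom_pair.induct)
    case (1 a b)
    note IH = "1.IH" and pos = "1.prems"
    consider "a = b" | "b < a" | "a < b" by linarith
    then show ?case
    proof cases
      case 1
      have "f 1 = 1" "g 1 = 1" using f g unfolding is_codenominator_def by blast+
      then show ?thesis using 1 pos by simp
    next
      case 2
      let ?y = "of_nat b / of_nat (a - b) :: rat"
      have y: "?y > 0" using 2 pos by simp
      have e: "of_nat a / of_nat b = 1 + 1 / ?y"
        using 2 pos by (simp add: field_simps)
      have "f ?y = g ?y" using IH(1) 2 pos by simp
      moreover have "f (1 + 1 / ?y) = f ?y" "g (1 + 1 / ?y) = g ?y"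
        using f g y unfolding is_codenominator_def by blast+
      ultimately show ?thesis unfolding e by simp
    next
      case 3
      let ?y = "of_nat (b - a) / of_nat a :: rat"
      have y: "?y > 0" using 3 pos by simp
      have i: "1 / ?y = of_nat a / of_nat (b - a)" by simp
      have e: "of_nat a / of_nat b = 1 / (1 + ?y)"
        using 3 pos by (simp add: field_simps)
      have "f ?y = g ?y" "f (1 / ?y) = g (1 / ?y)" unfolding i using IH(2,3) 3 pos by simp_all
      moreover have "f (1 / (1 + ?y)) = f ?y + f (1 / ?y)" "g (1 / (1 + ?y)) = g ?y + g (1 / ?y)"
        using f g y unfolding is_codenominator_def by blast+
      ultimately show ?thesis unfolding e by simp
    qed
  qed
  show "f x = g x"
  proof (cases "x > 0")
    case True
    then show ?thesis using * by (metis pos_rat_cases)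
  next
    case False
    then have "x \<le> 0" by simp
    then have "f x = 0" "g x = 0" using f g unfolding is_codenominator_def by blast+
    then show ?thesis by simp
  qed
qed

lemma is_codenominator_codenominator: "is_codenominator codenominator"
  unfolding codenominator_def
  by (rule theI[of is_codenominator, OF is_codenominator_witness])
     (rule is_codenominator_unique[OF _ is_codenominator_witness])

end

theory Submission
  imports Defs "HOL-Number_Theory.Fib"
begin

text \<open>
  The functional equations say that a translation by \<open>1\<close> maps the pair
  \<open>(F x, F (1 / x))\<close> to \<open>(F (1 / x), F x + F (1 / x))\<close>. Hence \<open>F (x + n)\<close> is
  a Fibonacci sequence in \<open>n\<close>, a fixed integer combination of \<open>F x\<close> and \<open>F (1 / x)\<close>,
  and \<open>F n\<close> is the \<open>n\<close>-th Fibonacci number. After the addition formula for Fibonacci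
  numbers the claim becomes a polynomial identity.
\<close>

lemma codenominator_one: "codenominator 1 = 1"
  using is_codenominator_codenominator unfolding is_codenominator_def by blast

lemma codenominator_plus_one:
  assumes "x > 0"
  shows "codenominator (x + 1) = codenominator (1 / x)"
proof -
  have "codenominator (1 + 1 / (1 / x)) = codenominator (1 / x)"
    using is_codenominator_codenominator assms unfolding is_codenominator_def
    by (meson zero_less_divide_1_iff)
  then show ?thesis by (simp add: add.commute)
qed

lemma codenominator_inverse_plus_one:
  assumes "x > 0"
  shows "codenominator (1 / (x + 1)) = codenominator x + codenominator (1 / x)"
  using is_codenominator_codenominator assms unfolding is_codenominator_def
  by (metis add.commute)

text \<open>The shift is written \<open>Suc n\<close> because the lower coefficient has index one
  below the shift: for a zero shift it would have to be 1, whereas \<open>fib (0 - 1)\<close> is 0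
  on naturals.\<close>

lemma codenominator_plus_Suc:
  assumes "x > 0"
  shows "codenominator (x + of_nat (Suc n)) =
    int (fib n) * codenominator x + int (fib (Suc n)) * codenominator (1 / x)"
  using assms
proof (induction n arbitrary: x)
  case 0
  then show ?case by (simp add: codenominator_plus_one)
next
  case (Suc n)
  \<comment> \<open>One unit moves into the base point, so the induction hypothesis is needed at
    \<open>x + 1\<close>; this is why \<open>x\<close> is arbitrary.\<close>
  have "codenominator (x + of_nat (Suc (Suc n))) = codenominator ((x + 1) + of_nat (Suc n))"
    by (simp add: algebra_simps)
  also have "\<dots> = int (fib n) * codenominator (x + 1) + int (fib (Suc n)) * codenominator (1 / (x + 1))"
    using Suc.prems by (intro Suc.IH) simp
  also have "\<dots> = int (fib (Suc n)) * codenominator x + int (fib (Suc (Suc n))) * codenominator (1 / x)"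
    unfolding codenominator_plus_one[OF Suc.prems] codenominator_inverse_plus_one[OF Suc.prems]
    by (simp add: algebra_simps)
  finally show ?case .
qed

lemma codenominator_of_nat:
  assumes "n > 0"
  shows "codenominator (of_nat n) = int (fib n)"
proof (cases "n = 1")
  case True
  then show ?thesis by (simp add: codenominator_one)
next
  case False
  with assms obtain m where "n = Suc (Suc m)" by (metis One_nat_def gr0_implies_Suc neq0_conv)
  \<comment> \<open>Shift by \<open>Suc m\<close> from base 1, where F(x) and F(1/x) both equal 1:
    the coefficients add up to \<open>fib m + fib (Suc m) = fib n\<close>.\<close>
  then show ?thesis
    using codenominator_plus_Suc[of 1 m] by (simp add: codenominator_one)
qed

text \<open>Since F(1/x) = F(x + 1), the reciprocal of an integer also has a Fibonacci value. The
  form is left unevaluated, although Cassini's identity makes it 1 or -1, because it appears as a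
  factor in the final expansion.\<close>

lemma codiscriminant_Suc:
  "codiscriminant (of_nat (Suc n)) =
    int (fib n) ^ 2 + int (fib n) * int (fib (Suc n)) - int (fib (Suc n)) ^ 2"
proof -
  have "codenominator (1 / of_nat (Suc n)) = codenominator (of_nat (Suc (Suc n)))"
    using codenominator_plus_one[of "of_nat (Suc n)"] by (simp add: add.commute)
  then show ?thesis
    unfolding codiscriminant_def
    by (simp add: codenominator_of_nat power2_eq_square algebra_simps del: of_nat_Suc)
qed

lemma fib_Suc_add_Suc:
  "fib (Suc m + Suc n) = fib m * fib (Suc n) + fib (Suc m) * fib n + fib (Suc m) * fib (Suc n)"
  using fib_add[of "Suc m" n] by (simp add: algebra_simps)

text \<open>The two shifts merge into one, and the addition formula splits its coefficients into the
  same four Fibonacci numbers that occur in the separate shifts.\<close>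

lemma codenominator_plus_Suc_Suc:
  assumes "x > 0"
  shows "codenominator (x + of_nat (Suc m) + of_nat (Suc n)) =
    (int (fib m) * int (fib n) + int (fib (Suc m)) * int (fib (Suc n))) * codenominator x +
    (int (fib m) * int (fib (Suc n)) + int (fib (Suc m)) * int (fib n)
      + int (fib (Suc m)) * int (fib (Suc n))) * codenominator (1 / x)"
proof -
  have "codenominator (x + of_nat (Suc m) + of_nat (Suc n)) =
      codenominator (x + of_nat (Suc (Suc m + n)))"
    by (simp add: algebra_simps)
  also have "\<dots> = int (fib (Suc (m + n))) * codenominator x
      + int (fib (Suc m + Suc n)) * codenominator (1 / x)"
    using codenominator_plus_Suc[OF assms, of "Suc m + n"] by simp
  also have "fib (Suc (m + n)) = fib m * fib n + fib (Suc m) * fib (Suc n)"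
    using fib_add[of n m] by (simp add: algebra_simps)
  finally show ?thesis
    unfolding fib_Suc_add_Suc by simp
qed

lemma pos_rat_Ints_cases:
  fixes x :: rat
  assumes "x \<in> \<int>" "x > 0"
  obtains n where "x = of_nat (Suc n)"
  using assms by (metis Ints_cases of_int_0_less_iff of_int_of_nat_eq zero_less_imp_eq_int
      gr0_implies_Suc)

text \<open>Expanding around \<open>p\<close> gives quadratic forms in F(p) and F(1/p); their
  difference is \<open>fib (Suc m) * fib (Suc n)\<close> times the codiscriminant of
  \<open>p\<close>.\<close>

lemma codenominator_identity_integer_shifts:
  fixes p q r :: rat
  assumes "p > 0" "q > 0" "r > 0" "q \<in> \<int>" "r \<in> \<int>"
  shows "codenominator (p + q) * codenominator (p + r) - codenominator p * codenominator (p + q + r)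
    = codiscriminant p * codenominator q * codenominator r"
proof -
  obtain m n where qr: "q = of_nat (Suc m)" "r = of_nat (Suc n)"
    using assms by (metis pos_rat_Ints_cases)
  show ?thesis
    unfolding qr codiscriminant_def codenominator_plus_Suc_Suc[OF assms(1)]
      codenominator_plus_Suc[OF assms(1)] codenominator_of_nat[OF zero_less_Suc]
    by (simp add: power2_eq_square algebra_simps del: fib.simps)
qed

text \<open>Here \<open>r\<close> is the base point. Both products contain F(1/r) with coefficient
  F(p) F(p + q), so it cancels, and the coefficient of F(r) factors as the codiscriminant of
  \<open>p\<close> times F(q).\<close>

lemma codenominator_identity_integer_base:
  fixes p q r :: rat
  assumes "p > 0" "q > 0" "r > 0" "p \<in> \<int>" "q \<in> \<int>"
  shows "codenominator (p + q) * codenominator (p + r) - codenominator p * codenominator (p + q + r)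
    = codiscriminant p * codenominator q * codenominator r"
proof -
  obtain m n where pq: "p = of_nat (Suc m)" "q = of_nat (Suc n)"
    using assms by (metis pos_rat_Ints_cases)
  have "codenominator (p + q) = int (fib (Suc m + Suc n))"
    unfolding pq of_nat_add[symmetric] by (simp add: codenominator_of_nat del: of_nat_Suc)
  moreover have "p + r = r + of_nat (Suc m)" "p + q + r = r + of_nat (Suc m) + of_nat (Suc n)"
    by (simp_all add: pq)
  ultimately show ?thesis
    by (simp only: pq codenominator_plus_Suc_Suc[OF assms(3)] codenominator_plus_Suc[OF assms(3)]
        codenominator_of_nat codiscriminant_Suc fib_Suc_add_Suc zero_less_Suc)
      (simp add: power2_eq_square algebra_simps del: fib.simps)
qed

theorem theorem2:
  fixes p q r :: rat
  assumes "p > 0" and "q > 0" and "r > 0"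
    and "(p \<in> \<int> \<and> q \<in> \<int>) \<or> (p \<in> \<int> \<and> r \<in> \<int>) \<or> (q \<in> \<int> \<and> r \<in> \<int>)"
  shows "codenominator (p + q) * codenominator (p + r) - codenominator p * codenominator (p + q + r)
    = codiscriminant p * codenominator q * codenominator r"
  using assms(4)
proof (elim disjE conjE)
  assume "p \<in> \<int>" "q \<in> \<int>"
  then show ?thesis using assms by (intro codenominator_identity_integer_base)
next
  assume "p \<in> \<int>" "r \<in> \<int>"
  \<comment> \<open>The identity is symmetric in \<open>q\<close> and \<open>r\<close>.\<close>
  then show ?thesis
    using codenominator_identity_integer_base[of p r q] assms by (simp add: ac_simps)
next
  assume "q \<in> \<int>" "r \<in> \<int>"
  then show ?thesis using assms by (intro codenominator_identity_integer_shifts)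
qed

end
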